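(* Work in $\mathsf{ZFC}$ and assume that there exists a super-compact cardinal (alternatively, assume that there exist infinitely many Woodin cardinals followed by a measurable cardinal, i.e. a measurable cardinal above all of them). Let $$\mathscr{F}_{\mathrm{st}}=\Big\{A\subseteq\mathbb{N}\colon \lim_{n\to\infty}\frac{|A\cap\{1,\ldots,n\}|}{n}=1\Big\}$$ be the filter of statistical convergence. Then for every Banach space $X$ over $\mathbb{K}\in\{\mathbb{R},\mathbb{C}\}$ and every $\mathscr{F}_{\mathrm{st}}$-basis $(x_n)_{n=1}^\infty$ of $X$, all coordinate functionals $x\mapsto a_n(x)$ $(n\in\mathbb{N})$ associated to $(x_n)_{n=1}^\infty$ are continuous.
   Context: For a filter $\mathscr{F}$ on $\mathbb{N}$, a sequence $(y_n)_{n=1}^\infty$ in a metric space $(M,d)$ $\mathscr{F}$-converges to $y$, written $y=\lim_{n,\mathscr{F}}y_n$, if for every $\varepsilon>0$ there is $A\in\mathscr{F}$ with $d(y,y_n)<\varepsilon$ for all $n\in A$. A sequence $(x_n)_{n=1}^\infty$ in a Banach space $X$ is an $\mathscr{F}$-basis of $X$ if for every $x\in X$ there exists a unique sequence of scalars $(a_n(x))_{n=1}^\infty$ such that $x=\lim_{n,\mathscr{F}}\sum_{j=1}^n a_j(x)x_j$. The linear functionals $x\mapsto a_n(x)$ $(n\in\mathbb{N})$ are the coordinate functionals of the basis; no continuity is assumed in the definition. *)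

theory Defs
  imports "HOL-Analysis.Analysis"
begin

section \<open>Statistical convergence and filter bases\<close>

definition density_one_sets :: "nat set set" where
  "density_one_sets = {A. (\<lambda>n. real (card (A \<inter> {1..n})) / real n) \<longlonglongrightarrow> 1}"

definition stat_filter :: "nat filter" where
  "stat_filter = Abs_filter (\<lambda>P. {n. P n} \<in> density_one_sets)"

lemma density_one_sets_mono:
  assumes "A \<in> density_one_sets" "A \<subseteq> B"
  shows "B \<in> density_one_sets"
  unfolding density_one_sets_def mem_Collect_eq
proof (rule tendsto_sandwich)
  show "\<forall>\<^sub>F n in sequentially. real (card (A \<inter> {1..n})) / real n \<le> real (card (B \<inter> {1..n})) / real n"
    using assms(2) by (intro always_eventually allI divide_right_mono) (auto intro!: card_mono)
  have "card (B \<inter> {1..n}) \<le> n" for n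
    using card_mono[of "{1..n}" "B \<inter> {1..n}"] by simp
  then show "\<forall>\<^sub>F n in sequentially. real (card (B \<inter> {1..n})) / real n \<le> 1"
    by (intro always_eventually allI) (auto simp: divide_le_eq_1)
  show "(\<lambda>n. real (card (A \<inter> {1..n})) / real n) \<longlonglongrightarrow> 1"
    using assms(1) by (simp add: density_one_sets_def)
qed simp

lemma density_one_sets_Int:
  assumes "A \<in> density_one_sets" "B \<in> density_one_sets"
  shows "A \<inter> B \<in> density_one_sets"
  unfolding density_one_sets_def mem_Collect_eq
proof (rule tendsto_sandwich)
  have ge: "card (A \<inter> {1..n}) + card (B \<inter> {1..n}) \<le> n + card (A \<inter> B \<inter> {1..n})" for n
  proof -
    have "card (A \<inter> {1..n}) + card (B \<inter> {1..n})
        = card ((A \<union> B) \<inter> {1..n}) + card (A \<inter> B \<inter> {1..n})"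
      using card_Un_Int[of "A \<inter> {1..n}" "B \<inter> {1..n}"]
      by (simp add: Int_Un_distrib2 Int_ac)
    moreover have "card ((A \<union> B) \<inter> {1..n}) \<le> n"
      using card_mono[of "{1..n}" "(A \<union> B) \<inter> {1..n}"] by simp
    ultimately show ?thesis by linarith
  qed
  show "\<forall>\<^sub>F n in sequentially. real (card (A \<inter> {1..n})) / real n
      + real (card (B \<inter> {1..n})) / real n - 1 \<le> real (card (A \<inter> B \<inter> {1..n})) / real n"
    using eventually_gt_at_top[of 0]
  proof eventually_elim
    case (elim n)
    have "real (card (A \<inter> {1..n})) + real (card (B \<inter> {1..n}))
        \<le> real n + real (card (A \<inter> B \<inter> {1..n}))"
      using ge[of n] by linarith
    then have "(real (card (A \<inter> {1..n})) + real (card (B \<inter> {1..n}))) / real n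
        \<le> (real n + real (card (A \<inter> B \<inter> {1..n}))) / real n"
      by (rule divide_right_mono) simp
    then show ?case
      using elim by (simp add: add_divide_distrib)
  qed
  have "card (A \<inter> B \<inter> {1..n}) \<le> n" for n
    using card_mono[of "{1..n}" "A \<inter> B \<inter> {1..n}"] by simp
  then show "\<forall>\<^sub>F n in sequentially. real (card (A \<inter> B \<inter> {1..n})) / real n \<le> 1"
    by (intro always_eventually allI) (auto simp: divide_le_eq_1)
  have "(\<lambda>n. real (card (A \<inter> {1..n})) / real n + real (card (B \<inter> {1..n})) / real n - 1)
      \<longlonglongrightarrow> 1 + 1 - 1"
    using assms by (intro tendsto_intros) (simp_all add: density_one_sets_def)
  then show "(\<lambda>n. real (card (A \<inter> {1..n})) / real n + real (card (B \<inter> {1..n})) / real n - 1)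
      \<longlonglongrightarrow> 1" by simp
qed simp

lemma UNIV_density_one: "UNIV \<in> density_one_sets"
proof -
  have "\<forall>\<^sub>F n in sequentially. real (card (UNIV \<inter> {1..n})) / real n = 1"
    using eventually_gt_at_top[of 0] by eventually_elim simp
  then show ?thesis
    unfolding density_one_sets_def mem_Collect_eq by (rule tendsto_eventually)
qed

lemma eventually_stat_filter:
  "eventually P stat_filter \<longleftrightarrow> {n. P n} \<in> density_one_sets"
  unfolding stat_filter_def
proof (rule eventually_Abs_filter, rule is_filter.intro)
  show "{n. True} \<in> density_one_sets"
    using UNIV_density_one by simp
  show "{n. P n \<and> Q n} \<in> density_one_sets"
    if "{n. P n} \<in> density_one_sets" "{n. Q n} \<in> density_one_sets" for P Q
    using density_one_sets_Int[OF that] by (simp add: Collect_conj_eq)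
  show "{n. Q n} \<in> density_one_sets"
    if "\<forall>x. P x \<longrightarrow> Q x" "{n. P n} \<in> density_one_sets" for P Q
    using density_one_sets_mono[OF that(2), of "{n. Q n}"] that(1) by auto
qed

lemma tendsto_stat_filter_iff:
  fixes y :: "nat \<Rightarrow> 'a::metric_space"
  shows "(y \<longlongrightarrow> l) stat_filter \<longleftrightarrow>
    (\<forall>e>0. \<exists>A\<in>density_one_sets. \<forall>n\<in>A. dist l (y n) < e)"
proof -
  have "{n. dist (y n) l < e} \<in> density_one_sets \<longleftrightarrow>
      (\<exists>A\<in>density_one_sets. \<forall>n\<in>A. dist l (y n) < e)" for e
    by (auto simp: dist_commute intro: density_one_sets_mono)
  then show ?thesis by (simp add: tendsto_iff eventually_stat_filter)
qed

text \<open>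
  The vector \<open>x j\<close> and the scalar \<open>a j\<close> are the ones with number \<open>j + 1\<close>, so that
  \<open>\<Sum>j<n\<close> runs over the first \<open>n\<close> terms. The scalar multiplication is a parameter, so that
  the same definition serves real and complex spaces.
\<close>

definition represents ::
  "nat filter \<Rightarrow> ('k \<Rightarrow> 'a::real_normed_vector \<Rightarrow> 'a) \<Rightarrow> (nat \<Rightarrow> 'a) \<Rightarrow> 'a \<Rightarrow> (nat \<Rightarrow> 'k) \<Rightarrow> bool" where
  "represents F sm x v a \<longleftrightarrow> ((\<lambda>n. \<Sum>j<n. sm (a j) (x j)) \<longlongrightarrow> v) F"

definition filter_basis ::
  "nat filter \<Rightarrow> ('k \<Rightarrow> 'a::real_normed_vector \<Rightarrow> 'a) \<Rightarrow> (nat \<Rightarrow> 'a) \<Rightarrow> bool" where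
  "filter_basis F sm x \<longleftrightarrow> (\<forall>v. \<exists>!a. represents F sm x v a)"

definition coordinate ::
  "nat filter \<Rightarrow> ('k \<Rightarrow> 'a::real_normed_vector \<Rightarrow> 'a) \<Rightarrow> (nat \<Rightarrow> 'a) \<Rightarrow> nat \<Rightarrow> 'a \<Rightarrow> 'k" where
  "coordinate F sm x n v = (THE a. represents F sm x v a) n"

text \<open>
  A complex Banach space is a type of class \<open>banach\<close> together with a complex scalar
  multiplication that extends the real one and for which the norm is homogeneous.
\<close>

locale complex_banach_space = vector_space scaleC
  for scaleC :: "complex \<Rightarrow> 'a::banach \<Rightarrow> 'a" +
  assumes scaleC_of_real: "scaleC (of_real r) v = r *\<^sub>R v"
    and norm_scaleC: "norm (scaleC c v) = cmod c * norm v"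


section \<open>Set-theoretic universes and large cardinals\<close>

text \<open>First-order formulas of the language of set theory; variables are natural numbers.\<close>

datatype set_formula =
    Mem nat nat
  | Equal nat nat
  | Neg set_formula
  | Conj set_formula set_formula
  | Forall nat set_formula

text \<open>
  ZFC in higher-order logic: the elements of \<open>'v\<close> are the sets, and Separation and Replacement
  range over all predicates and functions on \<open>'v\<close>. Hence a class, i.e. a \<open>'v set\<close>, contained in
  a set is a set, and \<open>\<omega>\<close> and the power sets of the universe are the true ones.
\<close>

locale zfc_universe =
  fixes elem :: "'v \<Rightarrow> 'v \<Rightarrow> bool" (infix "\<^bold>\<in>" 50)
  assumes extensionality: "(\<And>z. z \<^bold>\<in> x \<longleftrightarrow> z \<^bold>\<in> y) \<Longrightarrow> x = y"
    and foundation: "y \<^bold>\<in> x \<Longrightarrow> \<exists>y. y \<^bold>\<in> x \<and> \<not> (\<exists>z. z \<^bold>\<in> x \<and> z \<^bold>\<in> y)"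
    and pairing: "\<exists>p. \<forall>z. z \<^bold>\<in> p \<longleftrightarrow> z = x \<or> z = y"
    and union: "\<exists>u. \<forall>z. z \<^bold>\<in> u \<longleftrightarrow> (\<exists>y. y \<^bold>\<in> x \<and> z \<^bold>\<in> y)"
    and power_set: "\<exists>p. \<forall>z. z \<^bold>\<in> p \<longleftrightarrow> (\<forall>w. w \<^bold>\<in> z \<longrightarrow> w \<^bold>\<in> x)"
    and infinity: "\<exists>w. (\<exists>e. e \<^bold>\<in> w \<and> (\<forall>z. \<not> z \<^bold>\<in> e)) \<and>
      (\<forall>x. x \<^bold>\<in> w \<longrightarrow> (\<exists>y. y \<^bold>\<in> w \<and> (\<forall>z. z \<^bold>\<in> y \<longleftrightarrow> z \<^bold>\<in> x \<or> z = x)))"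
    and separation: "\<exists>y. \<forall>z. z \<^bold>\<in> y \<longleftrightarrow> z \<^bold>\<in> x \<and> P z"
    and replacement: "\<exists>y. \<forall>z. z \<^bold>\<in> y \<longleftrightarrow> (\<exists>w. w \<^bold>\<in> x \<and> z = G w)"
    and choice: "(\<And>y. y \<^bold>\<in> x \<Longrightarrow> \<exists>z. z \<^bold>\<in> y) \<Longrightarrow>
      (\<And>y y' z. y \<^bold>\<in> x \<Longrightarrow> y' \<^bold>\<in> x \<Longrightarrow> z \<^bold>\<in> y \<Longrightarrow> z \<^bold>\<in> y' \<Longrightarrow> y = y') \<Longrightarrow>
      \<exists>c. \<forall>y. y \<^bold>\<in> x \<longrightarrow> (\<exists>!z. z \<^bold>\<in> y \<and> z \<^bold>\<in> c)"
begin

definition ext :: "'v \<Rightarrow> 'v set" where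
  "ext x = {z. z \<^bold>\<in> x}"

text \<open>The set whose elements are exactly the members of the class \<open>A\<close>, if there is one.\<close>

definition set_of :: "'v set \<Rightarrow> 'v" where
  "set_of A = (THE y. ext y = A)"

definition opair :: "'v \<Rightarrow> 'v \<Rightarrow> 'v" where
  "opair x y = set_of {set_of {x}, set_of {x, y}}"

text \<open>The restriction of \<open>f\<close> to the set \<open>x\<close>, as a set of ordered pairs, and application of such
  a set of pairs.\<close>

definition graph :: "'v \<Rightarrow> ('v \<Rightarrow> 'v) \<Rightarrow> 'v" where
  "graph x f = set_of ((\<lambda>z. opair z (f z)) ` ext x)"

definition app :: "'v \<Rightarrow> 'v \<Rightarrow> 'v" where
  "app g x = (THE y. opair x y \<^bold>\<in> g)"

definition transitive_class :: "'v set \<Rightarrow> bool" where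
  "transitive_class M \<longleftrightarrow> (\<forall>x\<in>M. ext x \<subseteq> M)"

definition ordinal :: "'v \<Rightarrow> bool" where
  "ordinal \<alpha> \<longleftrightarrow> transitive_class (ext \<alpha>) \<and> (\<forall>\<beta>\<in>ext \<alpha>. transitive_class (ext \<beta>))"

definition cardinal :: "'v \<Rightarrow> bool" where
  "cardinal \<kappa> \<longleftrightarrow> ordinal \<kappa> \<and> (\<forall>\<alpha>\<in>ext \<kappa>. \<nexists>h. bij_betw h (ext \<alpha>) (ext \<kappa>))"

text \<open>\<open>in_level x \<alpha>\<close> says that \<open>x\<close> belongs to the level
  \<open>V\<^sub>\<alpha> = (\<Union>\<beta>\<in>\<alpha>. Pow V\<^sub>\<beta>)\<close> of the cumulative hierarchy.\<close>

inductive in_level :: "'v \<Rightarrow> 'v \<Rightarrow> bool" where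
  "\<beta> \<^bold>\<in> \<alpha> \<Longrightarrow> (\<And>y. y \<^bold>\<in> x \<Longrightarrow> in_level y \<beta>) \<Longrightarrow> in_level x \<alpha>"

primrec satisfies :: "'v set \<Rightarrow> (nat \<Rightarrow> 'v) \<Rightarrow> set_formula \<Rightarrow> bool" where
  "satisfies M s (Mem i j) \<longleftrightarrow> s i \<^bold>\<in> s j"
| "satisfies M s (Equal i j) \<longleftrightarrow> s i = s j"
| "satisfies M s (Neg \<phi>) \<longleftrightarrow> \<not> satisfies M s \<phi>"
| "satisfies M s (Conj \<phi> \<psi>) \<longleftrightarrow> satisfies M s \<phi> \<and> satisfies M s \<psi>"
| "satisfies M s (Forall i \<phi>) \<longleftrightarrow> (\<forall>x\<in>M. satisfies M (s(i := x)) \<phi>)"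

text \<open>\<open>j\<close> is an elementary embedding of the universe into the transitive class \<open>M\<close>. Such an \<open>M\<close>
  automatically contains all ordinals.\<close>

definition elementary_embedding :: "('v \<Rightarrow> 'v) \<Rightarrow> 'v set \<Rightarrow> bool" where
  "elementary_embedding j M \<longleftrightarrow> transitive_class M \<and> range j \<subseteq> M \<and>
    (\<forall>\<phi> s. satisfies UNIV s \<phi> \<longleftrightarrow> satisfies M (j \<circ> s) \<phi>)"

definition critical_point :: "('v \<Rightarrow> 'v) \<Rightarrow> 'v \<Rightarrow> bool" where
  "critical_point j \<kappa> \<longleftrightarrow> ordinal \<kappa> \<and> j \<kappa> \<noteq> \<kappa> \<and> (\<forall>\<alpha>\<in>ext \<kappa>. j \<alpha> = \<alpha>)"

definition closed_under_sequences :: "'v \<Rightarrow> 'v set \<Rightarrow> bool" where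
  "closed_under_sequences \<gamma> M \<longleftrightarrow> (\<forall>f. f ` ext \<gamma> \<subseteq> M \<longrightarrow> graph \<gamma> f \<in> M)"

definition supercompact :: "'v \<Rightarrow> bool" where
  "supercompact \<kappa> \<longleftrightarrow> cardinal \<kappa> \<and>
    (\<forall>\<gamma>. ordinal \<gamma> \<longrightarrow> (\<exists>j M. elementary_embedding j M \<and> critical_point j \<kappa> \<and>
      \<gamma> \<^bold>\<in> j \<kappa> \<and> closed_under_sequences \<gamma> M))"

text \<open>In \<open>woodin\<close>, \<open>app (j (graph \<delta> f)) \<kappa>\<close> is the ordinal usually written \<open>j(f)(\<kappa>)\<close>.\<close>

definition woodin :: "'v \<Rightarrow> bool" where
  "woodin \<delta> \<longleftrightarrow> cardinal \<delta> \<and>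
    (\<forall>f. f ` ext \<delta> \<subseteq> ext \<delta> \<longrightarrow>
      (\<exists>\<kappa>\<in>ext \<delta>. f ` ext \<kappa> \<subseteq> ext \<kappa> \<and>
        (\<exists>j M. elementary_embedding j M \<and> critical_point j \<kappa> \<and>
          {x. in_level x (app (j (graph \<delta> f)) \<kappa>)} \<subseteq> M)))"

definition complete_nonprincipal_ultrafilter :: "'v \<Rightarrow> 'v set set \<Rightarrow> bool" where
  "complete_nonprincipal_ultrafilter \<kappa> U \<longleftrightarrow>
    U \<subseteq> Pow (ext \<kappa>) \<and> ext \<kappa> \<in> U \<and> {} \<notin> U \<and>
    (\<forall>A\<in>U. \<forall>B. A \<subseteq> B \<and> B \<subseteq> ext \<kappa> \<longrightarrow> B \<in> U) \<and>
    (\<forall>A\<subseteq>ext \<kappa>. A \<in> U \<or> ext \<kappa> - A \<in> U) \<and>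
    (\<forall>\<gamma>\<in>ext \<kappa>. \<forall>A. (\<forall>\<xi>\<in>ext \<gamma>. A \<xi> \<in> U) \<longrightarrow> ext \<kappa> \<inter> (\<Inter>\<xi>\<in>ext \<gamma>. A \<xi>) \<in> U) \<and>
    (\<forall>\<xi>\<in>ext \<kappa>. {\<xi>} \<notin> U)"

definition measurable_cardinal :: "'v \<Rightarrow> bool" where
  "measurable_cardinal \<kappa> \<longleftrightarrow> cardinal \<kappa> \<and> uncountable (ext \<kappa>) \<and>
    (\<exists>U. complete_nonprincipal_ultrafilter \<kappa> U)"

end

end

theory Submission
  imports Defs
begin

text \<open>
  The argument follows Banach's classical proof that Schauder bases have continuous coordinate
  functionals; the point is to find, for statistical convergence, a substitute for the supremum norm
  of the partial sums.

  The density ideal has a metric description: \<open>y\<close> converges statistically to \<open>0\<close> if and only if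
  the means \<open>(\<Sum>k=1..n. min 1 (norm (y k))) / n\<close> tend to \<open>0\<close>. The supremum of these means over
  \<open>n\<close> defines an invariant metric that controls every term \<open>y n\<close> with \<open>n \<ge> 1\<close>, and for which the
  statistically convergent sequences form a complete group. For a basis \<open>x\<close> let \<open>sup_mean v\<close> be
  this supremum for the partial sums of the expansion of \<open>v\<close>. Completeness appears as countable
  subadditivity of \<open>sup_mean\<close>: if \<open>\<Sum>i. sup_mean (f i)\<close> converges and the vectors \<open>f i\<close> sum to \<open>v\<close>,
  then the sums of the coordinates of the \<open>f i\<close> represent \<open>v\<close>, hence by uniqueness are the
  coordinates of \<open>v\<close>, and \<open>sup_mean v \<le> (\<Sum>i. sup_mean (f i))\<close>. Moreover \<open>sup_mean (v /\<^sub>R m)\<close>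
  tends to \<open>0\<close> for every \<open>v\<close>, because an initial segment of the partial sums is bounded and the rest
  is close to \<open>v\<close> on average.

  A functional with these properties on a Banach space is continuous at \<open>0\<close> by the Baire category
  theorem (Zabreiko's lemma, which also yields the open mapping theorem). So the partial sums, and
  with them the coordinates, are small when \<open>v\<close> is small; by linearity the coordinates are
  continuous everywhere. The argument is uniform in a complete normed field of scalars that extends
  the reals, which covers the real and the complex case together.
\<close>

section \<open>Zabreiko's lemma\<close>

text \<open>
  By Baire, some set \<open>{v. p (v /\<^sub>R m) \<le> e / 2}\<close> is dense in a ball. Differences of its elements are
  dense in a ball around \<open>0\<close>, and scaling by \<open>1 / m\<close> gives the claim.
\<close>

lemma ball_subset_closure_sublevel:
  fixes p :: "'a::banach \<Rightarrow> real"
  assumes diff: "\<And>u v. p (u - v) \<le> p u + p v"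
    and absorbing: "\<And>v. (\<lambda>m. p (v /\<^sub>R real m)) \<longlonglongrightarrow> 0"
    and "e > 0"
  obtains d where "d > 0" "ball 0 d \<subseteq> closure {v. p v \<le> e}"
proof -
  define S where "S m = {v. p (v /\<^sub>R real (Suc m)) \<le> e/2}" for m
  have "v \<in> (\<Union>m. closure (S m))" for v
  proof -
    have "(\<lambda>m. p (v /\<^sub>R real (Suc m))) \<longlonglongrightarrow> 0"
      using absorbing[of v] by (rule LIMSEQ_Suc)
    then have "\<forall>\<^sub>F m in sequentially. p (v /\<^sub>R real (Suc m)) < e/2"
      using \<open>e > 0\<close> by (intro order_tendstoD) auto
    then obtain m where "p (v /\<^sub>R real (Suc m)) < e/2"
      using eventually_happens'[OF sequentially_bot] by blast
    then have "v \<in> S m" by (simp add: S_def)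
    then show ?thesis using closure_subset by blast
  qed
  then have cover: "(\<Union>m. closure (S m)) = UNIV" by blast
  have "\<exists>m. interior (closure (S m)) \<noteq> {}"
  proof (rule ccontr)
    assume *: "\<nexists>m. interior (closure (S m)) \<noteq> {}"
    have "euclidean interior_of \<Union>(range (\<lambda>m. closure (S m))) = {}"
      by (rule Baire_category_alt) (use * in \<open>auto simp: completely_metrizable_space_euclidean\<close>)
    then show False using cover by simp
  qed
  then obtain m u where "u \<in> interior (closure (S m))" by blast
  then obtain r where r: "r > 0" "ball u r \<subseteq> closure (S m)"
    unfolding mem_interior by blast
  show ?thesis
  proof
    show "r / real (Suc m) > 0" using r by simp
    show "ball 0 (r / real (Suc m)) \<subseteq> closure {v. p v \<le> e}"
    proof
      fix w :: 'a
      assume "w \<in> ball 0 (r / real (Suc m))"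
      then have "norm w * real (Suc m) < r"
        by (simp add: pos_less_divide_eq del: of_nat_Suc)
      then have "u + real (Suc m) *\<^sub>R w \<in> ball u r"
        by (simp add: dist_norm mult.commute del: of_nat_Suc)
      then have "u + real (Suc m) *\<^sub>R w \<in> closure (S m)" "u \<in> closure (S m)"
        using r by auto
      then obtain f g where f: "\<And>i. f i \<in> S m" "f \<longlonglongrightarrow> u + real (Suc m) *\<^sub>R w"
        and g: "\<And>i. g i \<in> S m" "g \<longlonglongrightarrow> u"
        unfolding closure_sequential by blast
      have "(\<lambda>i. (f i - g i) /\<^sub>R real (Suc m)) \<longlonglongrightarrow> (u + real (Suc m) *\<^sub>R w - u) /\<^sub>R real (Suc m)"
        by (intro tendsto_intros f g)
      then have "(\<lambda>i. (f i - g i) /\<^sub>R real (Suc m)) \<longlonglongrightarrow> w"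
        by (simp del: of_nat_Suc)
      moreover have "p ((f i - g i) /\<^sub>R real (Suc m)) \<le> e" for i
        using diff[of "f i /\<^sub>R real (Suc m)" "g i /\<^sub>R real (Suc m)"] f(1)[of i] g(1)[of i]
        by (simp add: S_def scaleR_diff_right del: of_nat_Suc)
      ultimately show "w \<in> closure {v. p v \<le> e}"
        unfolding closure_sequential by (intro exI[of _ "\<lambda>i. (f i - g i) /\<^sub>R real (Suc m)"]) simp
    qed
  qed
qed

text \<open>
  Every small \<open>w\<close> is the sum of a series of vectors with \<open>\<Sum>i. p (f i) \<le> e\<close>: approximate \<open>w\<close> by a
  vector of the sublevel set \<open>p \<le> e / 2\<close>, then the error by a vector of the set \<open>p \<le> e / 4\<close>, and
  so on; density leaves the next error arbitrarily small.
\<close>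

lemma zabreiko:
  fixes p :: "'a::banach \<Rightarrow> real"
  assumes nonneg: "\<And>v. 0 \<le> p v"
    and minus: "\<And>v. p (- v) = p v"
    and absorbing: "\<And>v. (\<lambda>m. p (v /\<^sub>R real m)) \<longlonglongrightarrow> 0"
    and subadditive: "\<And>f v. f sums v \<Longrightarrow> summable (\<lambda>i. p (f i)) \<Longrightarrow> p v \<le> (\<Sum>i. p (f i))"
  shows "(p \<longlongrightarrow> 0) (nhds 0)"
proof -
  have p0: "p 0 = 0"
    using absorbing[of 0] by (simp add: LIMSEQ_const_iff)
  have diff: "p (u - v) \<le> p u + p v" for u v
  proof -
    define f where "f i = (if i = 0 then u else if i = 1 then - v else 0)" for i :: nat
    have "f sums (\<Sum>i<2. f i)"
      by (rule sums_finite) (auto simp: f_def)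
    moreover have "(\<lambda>i. p (f i)) sums (\<Sum>i<2. p (f i))"
      by (rule sums_finite) (auto simp: f_def p0)
    ultimately show ?thesis
      using subadditive[of f] by (auto simp: f_def minus numeral_2_eq_2 sums_iff)
  qed
  have small: "\<exists>d>0. \<forall>w. norm w < d \<longrightarrow> p w \<le> e" if "e > 0" for e
  proof -
    define E where "E i = e * (1/2) ^ Suc i" for i :: nat
    have E: "E sums e"
      using sums_mult[OF power_half_series, of e] by (simp add: E_def[abs_def])
    have "\<exists>d>0. d \<le> (1/2)^i \<and> ball 0 d \<subseteq> closure {v. p v \<le> E i}" for i :: nat
    proof -
      obtain d where "d > 0" "ball 0 d \<subseteq> closure {v. p v \<le> E i}"
        using ball_subset_closure_sublevel[OF diff absorbing, of "E i"] \<open>e > 0\<close>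
        by (auto simp: E_def)
      then show ?thesis
        by (intro exI[of _ "min d ((1/2)^i)"]) auto
    qed
    then obtain d where d: "\<And>i. d i > 0" "\<And>i. d i \<le> (1/2)^i"
      "\<And>i. ball 0 (d i) \<subseteq> closure {v. p v \<le> E i}"
      by metis
    have step: "\<exists>v. p v \<le> E i \<and> norm (u - v) < d (Suc i)" if "norm u < d i" for u i
    proof -
      have "u \<in> closure {v. p v \<le> E i}" by (rule subsetD[OF d(3)]) (simp add: that)
      then obtain v where "p v \<le> E i" "dist v u < d (Suc i)"
        unfolding closure_approachable using d(1) by blast
      then show ?thesis by (auto simp: dist_norm norm_minus_commute)
    qed
    define g where "g i u = (SOME v. p v \<le> E i \<and> norm (u - v) < d (Suc i))" for i u
    have g: "p (g i u) \<le> E i \<and> norm (u - g i u) < d (Suc i)" if "norm u < d i" for u i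
      unfolding g_def by (rule someI_ex) (rule step[OF that])
    have "p w \<le> e" if "norm w < d 0" for w
    proof -
      define err where "err = rec_nat w (\<lambda>i u. u - g i u)"
      have err_0: "err 0 = w" and err_Suc: "err (Suc i) = err i - g i (err i)" for i
        by (simp_all add: err_def)
      have err: "norm (err i) < d i" for i
        by (induction i) (use that g in \<open>auto simp: err_0 err_Suc\<close>)
      define f where "f i = g i (err i)" for i
      have pf: "p (f i) \<le> E i" for i
        using g err by (auto simp: f_def)
      have sumf: "(\<Sum>i<n. f i) = w - err n" for n
        by (induction n) (auto simp: err_0 err_Suc f_def)
      have "err \<longlonglongrightarrow> 0"
      proof (rule Lim_null_comparison)
        show "\<forall>\<^sub>F i in sequentially. norm (err i) \<le> (1/2)^i"
          using err d(2) by (intro always_eventually allI) (meson less_le_trans less_imp_le)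
        show "(\<lambda>i. (1/2::real)^i) \<longlonglongrightarrow> 0" by (rule LIMSEQ_realpow_zero) auto
      qed
      then have "(\<lambda>n. w - err n) \<longlonglongrightarrow> w - 0" by (intro tendsto_intros)
      then have "f sums w" by (simp add: sums_def sumf)
      moreover have "summable (\<lambda>i. p (f i))"
        by (rule summable_comparison_test'[OF sums_summable[OF E]]) (use pf nonneg in auto)
      ultimately have "p w \<le> (\<Sum>i. p (f i))" "(\<Sum>i. p (f i)) \<le> (\<Sum>i. E i)"
        using subadditive sums_summable[OF E] pf by (auto intro!: suminf_le)
      then show ?thesis using E by (simp add: sums_iff)
    qed
    then show ?thesis using d(1) by blast
  qed
  show ?thesis
  proof (rule tendstoI)
    fix e :: real assume "e > 0"
    then obtain d where d: "d > 0" "\<forall>w. norm w < d \<longrightarrow> p w \<le> e/2"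
      using small[of "e/2"] by auto
    show "\<forall>\<^sub>F v in nhds 0. dist (p v) 0 < e"
      unfolding eventually_nhds_metric
    proof (intro exI[of _ d] conjI allI impI d)
      fix v :: 'a assume "dist v 0 < d"
      then have "p v \<le> e/2" using d by simp
      then show "dist (p v) 0 < e" using nonneg[of v] \<open>e > 0\<close> by simp
    qed
  qed
qed


section \<open>Truncated means and statistical convergence\<close>

text \<open>Like the sets whose density is measured, the mean starts at the index \<open>1\<close>.\<close>

definition trunc_mean :: "(nat \<Rightarrow> 'a::real_normed_vector) \<Rightarrow> nat \<Rightarrow> real" where
  "trunc_mean y n = (\<Sum>k=1..n. min 1 (norm (y k))) / real n"

lemma trunc_mean_nonneg: "0 \<le> trunc_mean y n"
  by (auto simp: trunc_mean_def intro!: divide_nonneg_nonneg sum_nonneg)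

lemma trunc_mean_bound:
  assumes "\<And>k. k \<in> {1..n} \<Longrightarrow> norm (y k) \<le> c" "0 \<le> c"
  shows "trunc_mean y n \<le> c"
proof -
  have "(\<Sum>k=1..n. min 1 (norm (y k))) \<le> (\<Sum>k=1..n. c)"
    using assms by (intro sum_mono) (auto simp: min_le_iff_disj)
  then show ?thesis
    using assms(2) by (cases "n = 0") (auto simp: trunc_mean_def divide_simps mult.commute)
qed

lemma trunc_mean_le_1: "trunc_mean y n \<le> 1"
proof -
  have "(\<Sum>k=1..n. min 1 (norm (y k))) \<le> (\<Sum>k=1..n. 1)"
    by (intro sum_mono) auto
  then show ?thesis
    by (cases "n = 0") (auto simp: trunc_mean_def divide_simps)
qed

lemma trunc_mean_mono:
  assumes "\<And>k. norm (y k) \<le> norm (z k)"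
  shows "trunc_mean y n \<le> trunc_mean z n"
  unfolding trunc_mean_def
  by (intro divide_right_mono sum_mono min.mono assms) auto

lemma trunc_mean_add: "trunc_mean (\<lambda>k. y k + z k) n \<le> trunc_mean y n + trunc_mean z n"
proof -
  have "min 1 (norm (y k + z k)) \<le> min 1 (norm (y k)) + min 1 (norm (z k))" for k
    using norm_triangle_ineq[of "y k" "z k"] norm_ge_zero[of "y k"] norm_ge_zero[of "z k"]
    by linarith
  then show ?thesis
    unfolding trunc_mean_def add_divide_distrib[symmetric] sum.distrib[symmetric]
    by (intro divide_right_mono sum_mono) auto
qed

lemma trunc_mean_sum:
  fixes m :: nat
  shows "trunc_mean (\<lambda>k. \<Sum>i<m. y i k) n \<le> (\<Sum>i<m. trunc_mean (y i) n)"
proof (induction m)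
  case 0
  then show ?case by (simp add: trunc_mean_def)
next
  case (Suc m)
  then show ?case
    using trunc_mean_add[of "\<lambda>k. \<Sum>i<m. y i k" "y m" n] by simp
qed

lemma trunc_mean_suminf:
  assumes sums: "\<And>k. (\<lambda>i. y i k) sums z k"
    and le: "\<And>i. trunc_mean (y i) n \<le> q i"
    and "summable q"
  shows "trunc_mean z n \<le> suminf q"
proof (rule LIMSEQ_le_const2)
  show "(\<lambda>m. trunc_mean (\<lambda>k. \<Sum>i<m. y i k) n) \<longlonglongrightarrow> trunc_mean z n"
    using sums unfolding trunc_mean_def sums_def
    by (cases "n = 0") (auto intro!: tendsto_intros)
  have q: "0 \<le> q i" for i
    using trunc_mean_nonneg[of "y i" n] le[of i] by linarith
  have "trunc_mean (\<lambda>k. \<Sum>i<m. y i k) n \<le> suminf q" for m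
    using trunc_mean_sum[of y m n] sum_mono[of "{..<m}" "\<lambda>i. trunc_mean (y i) n" q]
      sum_le_suminf[OF \<open>summable q\<close>, of "{..<m}"] le q
    by force
  then show "\<exists>N. \<forall>m\<ge>N. trunc_mean (\<lambda>k. \<Sum>i<m. y i k) n \<le> suminf q" by blast
qed

lemma norm_le_trunc_mean:
  assumes "n > 0"
  shows "min 1 (norm (y n)) \<le> real n * trunc_mean y n"
  using assms member_le_sum[of n "{1..n}" "\<lambda>k. min 1 (norm (y k))"]
  by (simp add: trunc_mean_def)

text \<open>
  Markov's inequality: a set of indices on which \<open>norm (y n) \<ge> e\<close> contributes at least \<open>min 1 e\<close>
  times its relative frequency to the mean; conversely the truncation lets a set of small frequency
  contribute little.
\<close>

lemma stat_tendsto_0_iff: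
  "(y \<longlongrightarrow> 0) stat_filter \<longleftrightarrow> trunc_mean y \<longlonglongrightarrow> 0"
proof
  have count: "(\<Sum>k=1..n. if k \<in> A then 0 else 1) = real n - real (card (A \<inter> {1..n}))"
    for A :: "nat set" and n
  proof -
    have "(\<Sum>k=1..n. if k \<in> A then 0 else 1::real) = (\<Sum>k=1..n. 1 - indicator A k)"
      by (intro sum.cong) auto
    also have "\<dots> = real n - (\<Sum>k=1..n. indicator A k)"
      by (simp add: sum_subtractf)
    also have "(\<Sum>k=1..n. indicator A k) = real (card (A \<inter> {1..n}))"
      using sum_indicator_eq_card[of "{1..n}" A]
      by (simp add: Int_commute indicator_def if_distrib sum.If_cases)
    finally show ?thesis .
  qed
  {
    assume y: "(y \<longlongrightarrow> 0) stat_filter"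
    show "trunc_mean y \<longlonglongrightarrow> 0"
    proof (rule order_tendstoI)
      fix a :: real assume "a < 0"
      then show "\<forall>\<^sub>F n in sequentially. a < trunc_mean y n"
        using trunc_mean_nonneg[of y] by (intro always_eventually) (auto intro: less_le_trans)
    next
      fix e :: real assume "0 < e"
      define A where "A = {n. norm (y n) < e/2}"
      have "eventually (\<lambda>n. dist (y n) 0 < e/2) stat_filter"
        using y \<open>0 < e\<close> by (intro tendstoD) auto
      then have A: "(\<lambda>n. real (card (A \<inter> {1..n})) / real n) \<longlonglongrightarrow> 1"
        by (simp add: eventually_stat_filter A_def density_one_sets_def)
      have "(\<lambda>n. e/2 + (1 - real (card (A \<inter> {1..n})) / real n)) \<longlonglongrightarrow> e/2 + (1 - 1)"
        by (intro tendsto_intros A)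
      then have "\<forall>\<^sub>F n in sequentially. e/2 + (1 - real (card (A \<inter> {1..n})) / real n) < e"
        by (rule order_tendstoD) (use \<open>0 < e\<close> in simp)
      then show "\<forall>\<^sub>F n in sequentially. trunc_mean y n < e"
        using eventually_gt_at_top[of 0]
      proof eventually_elim
        case (elim n)
        have "(\<Sum>k=1..n. min 1 (norm (y k))) \<le> (\<Sum>k=1..n. e/2 + (if k \<in> A then 0 else 1))"
          using \<open>0 < e\<close> by (intro sum_mono) (auto simp: A_def min_le_iff_disj)
        also have "\<dots> = real n * (e/2) + (real n - real (card (A \<inter> {1..n})))"
          by (simp only: sum.distrib count) simp
        finally have "trunc_mean y n \<le> (real n * (e/2) + (real n - real (card (A \<inter> {1..n})))) / real n"
          unfolding trunc_mean_def by (rule divide_right_mono) simp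
        also have "\<dots> = e/2 + (1 - real (card (A \<inter> {1..n})) / real n)"
          using elim by (simp add: field_simps)
        finally show ?case using elim by linarith
      qed
    qed
  }
  assume y: "trunc_mean y \<longlonglongrightarrow> 0"
  show "(y \<longlongrightarrow> 0) stat_filter"
  proof (rule tendstoI)
    fix e :: real assume "0 < e"
    define A where "A = {n. norm (y n) < e}"
    define c where "c = min 1 e"
    have c: "0 < c" using \<open>0 < e\<close> by (simp add: c_def)
    have "(\<lambda>n. real (card (A \<inter> {1..n})) / real n) \<longlonglongrightarrow> 1"
    proof (rule tendsto_sandwich)
      have "(\<lambda>n. 1 - trunc_mean y n / c) \<longlonglongrightarrow> 1 - 0 / c"
        using c by (intro tendsto_intros y) auto
      then show "(\<lambda>n. 1 - trunc_mean y n / c) \<longlonglongrightarrow> 1" by simp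
      have "card (A \<inter> {1..n}) \<le> n" for n
        using card_mono[of "{1..n}" "A \<inter> {1..n}"] by simp
      then show "\<forall>\<^sub>F n in sequentially. real (card (A \<inter> {1..n})) / real n \<le> 1"
        by (intro always_eventually allI) (auto simp: divide_le_eq_1)
      show "\<forall>\<^sub>F n in sequentially. 1 - trunc_mean y n / c \<le> real (card (A \<inter> {1..n})) / real n"
        using eventually_gt_at_top[of 0]
      proof eventually_elim
        case (elim n)
        have "c * (real n - real (card (A \<inter> {1..n}))) = (\<Sum>k=1..n. c * (if k \<in> A then 0 else 1))"
          by (simp only: sum_distrib_left[symmetric] count)
        also have "\<dots> \<le> (\<Sum>k=1..n. min 1 (norm (y k)))"
          by (intro sum_mono) (auto simp: A_def c_def)
        also have "\<dots> = real n * trunc_mean y n"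
          using elim by (simp add: trunc_mean_def)
        finally show ?case
          using c elim by (simp add: field_simps)
      qed
    qed simp
    then show "\<forall>\<^sub>F n in stat_filter. dist (y n) 0 < e"
      by (simp add: eventually_stat_filter density_one_sets_def A_def)
  qed
qed

lemma stat_tendsto_iff:
  "(y \<longlongrightarrow> v) stat_filter \<longleftrightarrow> trunc_mean (\<lambda>n. y n - v) \<longlonglongrightarrow> 0"
  using Lim_null[of y v stat_filter] stat_tendsto_0_iff[of "\<lambda>n. y n - v"] by simp


section \<open>Coordinates of a statistical basis\<close>

locale normed_scaling = vector_space sm
  for sm :: "'k::{real_normed_field,banach} \<Rightarrow> 'a::banach \<Rightarrow> 'a" +
  assumes sm_of_real: "sm (of_real r) v = r *\<^sub>R v"
    and norm_sm: "norm (sm c v) = norm c * norm v"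
begin

lemma bounded_linear_sm_left: "bounded_linear (\<lambda>c. sm c v)"
proof (rule bounded_linear_intro[where K = "norm v"])
  show "sm (r *\<^sub>R c) v = r *\<^sub>R sm c v" for r c
    by (simp add: scaleR_conv_of_real sm_of_real[symmetric])
qed (simp_all add: scale_left_distrib norm_sm)

end

locale stat_basis = normed_scaling sm
  for sm :: "'k::{real_normed_field,banach} \<Rightarrow> 'a::banach \<Rightarrow> 'a" +
  fixes x :: "nat \<Rightarrow> 'a"
  assumes basis: "filter_basis stat_filter sm x"
begin

abbreviation coord :: "nat \<Rightarrow> 'a \<Rightarrow> 'k" where
  "coord \<equiv> coordinate stat_filter sm x"

definition psum :: "'a \<Rightarrow> nat \<Rightarrow> 'a" where
  "psum v n = (\<Sum>j<n. sm (coord j v) (x j))"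

definition sup_mean :: "'a \<Rightarrow> real" where
  "sup_mean v = (SUP n. trunc_mean (psum v) n)"

lemma psum_tendsto: "(psum v \<longlongrightarrow> v) stat_filter"
proof -
  have "\<exists>!a. represents stat_filter sm x v a"
    using basis by (simp add: filter_basis_def)
  then have "represents stat_filter sm x v (\<lambda>n. coord n v)"
    unfolding coordinate_def by (rule theI')
  then show ?thesis
    unfolding represents_def psum_def .
qed

lemma coord_eqI:
  assumes "((\<lambda>n. \<Sum>j<n. sm (a j) (x j)) \<longlongrightarrow> v) stat_filter"
  shows "coord n v = a n"
proof -
  have "(THE a. represents stat_filter sm x v a) = a"
    by (rule the1_equality)
      (use basis assms in \<open>auto simp: filter_basis_def represents_def\<close>)
  then show ?thesis by (simp add: coordinate_def)
qed

lemma coord_diff: "coord n (u - v) = coord n u - coord n v"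
proof (rule coord_eqI)
  have "((\<lambda>n. psum u n - psum v n) \<longlongrightarrow> u - v) stat_filter"
    by (intro tendsto_intros psum_tendsto)
  then show "((\<lambda>n. \<Sum>j<n. sm (coord j u - coord j v) (x j)) \<longlongrightarrow> u - v) stat_filter"
    by (simp add: psum_def scale_left_diff_distrib sum_subtractf)
qed

lemma coord_scaleR: "coord n (r *\<^sub>R v) = of_real r * coord n v"
proof (rule coord_eqI)
  have "((\<lambda>n. r *\<^sub>R psum v n) \<longlongrightarrow> r *\<^sub>R v) stat_filter"
    by (intro tendsto_intros psum_tendsto)
  then show "((\<lambda>n. \<Sum>j<n. sm (of_real r * coord j v) (x j)) \<longlongrightarrow> r *\<^sub>R v) stat_filter"
    by (simp only: psum_def scaleR_sum_right scale_scale[symmetric] sm_of_real)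
qed

lemma coord_0: "coord n 0 = 0"
  using coord_scaleR[of n 0 0] by simp

lemma psum_scaleR: "psum (r *\<^sub>R v) n = r *\<^sub>R psum v n"
  by (simp only: psum_def coord_scaleR scaleR_sum_right scale_scale[symmetric] sm_of_real)

text \<open>Otherwise \<open>0\<close> would have a second representation, with \<open>n\<close>-th coefficient \<open>1\<close>.\<close>

lemma basis_vector_nonzero: "x n \<noteq> 0"
proof
  assume "x n = 0"
  then have "(\<Sum>j<m. sm (if j = n then 1 else 0) (x j)) = 0" for m
    by (intro sum.neutral) auto
  then have "coord n 0 = (if n = n then 1 else 0)"
    by (intro coord_eqI) simp
  then show False by (simp add: coord_0)
qed

lemma norm_coord: "norm (coord n v) * norm (x n) = norm (psum v (Suc n) - psum v n)"
  by (simp add: psum_def norm_sm)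

lemma trunc_mean_le_sup_mean: "trunc_mean (psum v) n \<le> sup_mean v"
  unfolding sup_mean_def by (rule cSUP_upper) (auto intro!: bdd_aboveI2[of _ _ 1] trunc_mean_le_1)

lemma sup_mean_le: "(\<And>n. trunc_mean (psum v) n \<le> c) \<Longrightarrow> sup_mean v \<le> c"
  unfolding sup_mean_def by (rule cSUP_least) auto

lemma sup_mean_nonneg: "0 \<le> sup_mean v"
  using trunc_mean_nonneg[of "psum v" 0] trunc_mean_le_sup_mean[of v 0] by linarith

lemma sup_mean_minus: "sup_mean (- v) = sup_mean v"
proof -
  have "psum (- v) n = - psum v n" for n
    using psum_scaleR[of "-1" v n] by simp
  then have "trunc_mean (psum (- v)) = trunc_mean (psum v)"
    by (simp add: trunc_mean_def fun_eq_iff)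
  then show ?thesis by (simp add: sup_mean_def)
qed

lemma norm_psum_le_sup_mean: "min 1 (norm (psum v n)) \<le> real n * sup_mean v"
proof (cases "n = 0")
  case False
  then have "min 1 (norm (psum v n)) \<le> real n * trunc_mean (psum v) n"
    by (intro norm_le_trunc_mean) simp
  also have "\<dots> \<le> real n * sup_mean v"
    by (intro mult_left_mono trunc_mean_le_sup_mean) simp
  finally show ?thesis .
qed (simp add: psum_def)

text \<open>
  For large \<open>n\<close> the partial sums are close to \<open>v\<close> on average, so that the mean of the scaled
  sequence is at most \<open>e / 2 + norm v / m\<close>; the finitely many other means involve finitely many
  partial sums.
\<close>

lemma sup_mean_absorbing: "(\<lambda>m. sup_mean (v /\<^sub>R real m)) \<longlonglongrightarrow> 0"
proof (rule order_tendstoI)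
  fix a :: real assume "a < 0"
  then show "\<forall>\<^sub>F m in sequentially. a < sup_mean (v /\<^sub>R real m)"
    using sup_mean_nonneg by (intro always_eventually) (auto intro: less_le_trans)
next
  fix e :: real assume "0 < e"
  have "trunc_mean (\<lambda>n. psum v n - v) \<longlonglongrightarrow> 0"
    using psum_tendsto[of v] by (simp only: stat_tendsto_iff)
  then have "\<forall>\<^sub>F n in sequentially. trunc_mean (\<lambda>n. psum v n - v) n < e/2"
    using \<open>0 < e\<close> by (intro order_tendstoD) auto
  then obtain N where N: "\<And>n. n \<ge> N \<Longrightarrow> trunc_mean (\<lambda>n. psum v n - v) n < e/2"
    by (auto simp: eventually_sequentially)
  define C where "C = norm v + (\<Sum>k\<le>N. norm (psum v k))"
  have C: "norm v \<le> C" "0 \<le> C"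
    by (auto simp: C_def intro!: add_nonneg_nonneg sum_nonneg)
  have CN: "norm (psum v k) \<le> C" if "k \<le> N" for k
    using member_le_sum[of k "{..N}" "\<lambda>k. norm (psum v k)"] that
    by (auto simp: C_def intro: add_increasing)
  have bound: "sup_mean (v /\<^sub>R real m) \<le> e/2 + C / real m" if "m > 0" for m
  proof (rule sup_mean_le)
    fix n
    show "trunc_mean (psum (v /\<^sub>R real m)) n \<le> e/2 + C / real m"
    proof (cases "n \<ge> N")
      case True
      have "psum (v /\<^sub>R real m) = (\<lambda>k. (psum v k - v) /\<^sub>R real m + v /\<^sub>R real m)"
        by (simp add: psum_scaleR fun_eq_iff scaleR_diff_right)
      then have "trunc_mean (psum (v /\<^sub>R real m)) n
          \<le> trunc_mean (\<lambda>k. (psum v k - v) /\<^sub>R real m) n + trunc_mean (\<lambda>k. v /\<^sub>R real m) n"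
        using trunc_mean_add[of "\<lambda>k. (psum v k - v) /\<^sub>R real m" "\<lambda>k. v /\<^sub>R real m" n] by simp
      also have "trunc_mean (\<lambda>k. (psum v k - v) /\<^sub>R real m) n \<le> trunc_mean (\<lambda>k. psum v k - v) n"
        using that by (intro trunc_mean_mono) (auto simp: divide_simps mult_le_cancel_left1)
      also have "\<dots> \<le> e/2"
        using N[OF True] by simp
      also have "trunc_mean (\<lambda>k. v /\<^sub>R real m) n \<le> C / real m"
        using C that by (intro trunc_mean_bound) (auto simp: divide_simps)
      finally show ?thesis by simp
    next
      case False
      then have "trunc_mean (psum (v /\<^sub>R real m)) n \<le> C / real m"
        using C CN that by (intro trunc_mean_bound) (auto simp: psum_scaleR divide_simps)
      then show ?thesis using \<open>0 < e\<close> by simp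
    qed
  qed
  have "(\<lambda>m. e/2 + C / real m) \<longlonglongrightarrow> e/2 + 0"
    by (intro tendsto_add tendsto_const lim_const_over_n)
  then have "\<forall>\<^sub>F m in sequentially. e/2 + C / real m < e"
    by (rule order_tendstoD) (use \<open>0 < e\<close> in simp)
  then show "\<forall>\<^sub>F m in sequentially. sup_mean (v /\<^sub>R real m) < e"
    using eventually_gt_at_top[of 0]
  proof eventually_elim
    case (elim m)
    then show ?case using bound[of m] by linarith
  qed
qed

lemma summable_psum:
  assumes "summable (\<lambda>i. sup_mean (f i))"
  shows "summable (\<lambda>i. norm (psum (f i) n))"
proof -
  have "summable (\<lambda>i. real n * sup_mean (f i))"
    using assms by (rule summable_mult)
  then have "(\<lambda>i. real n * sup_mean (f i)) \<longlonglongrightarrow> 0"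
    by (rule summable_LIMSEQ_zero)
  then have "\<forall>\<^sub>F i in sequentially. real n * sup_mean (f i) < 1"
    by (intro order_tendstoD) auto
  then have "\<forall>\<^sub>F i in sequentially. norm (norm (psum (f i) n)) \<le> real n * sup_mean (f i)"
  proof eventually_elim
    case (elim i)
    then show ?case using norm_psum_le_sup_mean[of "f i" n] by simp
  qed
  then show ?thesis
    using \<open>summable (\<lambda>i. real n * sup_mean (f i))\<close> by (rule summable_comparison_test_ev)
qed

lemma summable_coord:
  assumes "summable (\<lambda>i. sup_mean (f i))"
  shows "summable (\<lambda>i. coord n (f i))"
proof -
  have "summable (\<lambda>i. (norm (psum (f i) (Suc n)) + norm (psum (f i) n)) / norm (x n))"
    using assms by (intro summable_divide summable_add summable_psum)
  moreover have "norm (coord n (f i)) \<le> (norm (psum (f i) (Suc n)) + norm (psum (f i) n)) / norm (x n)"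
    for i
    using norm_coord[of n "f i"] norm_triangle_ineq4[of "psum (f i) (Suc n)" "psum (f i) n"]
      basis_vector_nonzero[of n]
    by (simp add: pos_le_divide_eq)
  ultimately show ?thesis
    by (rule summable_comparison_test'[where N = 0])
qed

text \<open>
  The coordinatewise sums \<open>b\<close> of the expansions of the \<open>f i\<close> have partial sums \<open>T\<close>. To see that
  \<open>T\<close> converges statistically to \<open>v\<close>, cut the series at a large \<open>m\<close>: the first \<open>m\<close> expansions
  converge statistically to \<open>f 0, \<dots>, f (m - 1)\<close>, and the tail contributes to every mean at most
  \<open>\<Sum>i. sup_mean (f (i + m))\<close>, uniformly in \<open>n\<close>.
\<close>

lemma sup_mean_countably_subadditive:
  assumes f: "f sums v" and sp: "summable (\<lambda>i. sup_mean (f i))"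
  shows "sup_mean v \<le> (\<Sum>i. sup_mean (f i))"
proof -
  define b where "b n = (\<Sum>i. coord n (f i))" for n
  define T where "T n = (\<Sum>j<n. sm (b j) (x j))" for n
  have T: "(\<lambda>i. psum (f i) n) sums T n" for n
    unfolding psum_def T_def b_def
    by (intro sums_sum bounded_linear.sums[OF bounded_linear_sm_left] summable_sums
        summable_coord[OF sp])
  have "trunc_mean (\<lambda>n. T n - v) \<longlonglongrightarrow> 0"
  proof (rule order_tendstoI)
    fix a :: real assume "a < 0"
    then show "\<forall>\<^sub>F n in sequentially. a < trunc_mean (\<lambda>n. T n - v) n"
      using trunc_mean_nonneg by (intro always_eventually) (auto intro: less_le_trans)
  next
    fix e :: real assume "0 < e"
    have "(\<lambda>m. (\<Sum>i. sup_mean (f i)) - (\<Sum>i<m. sup_mean (f i))) \<longlonglongrightarrow> (\<Sum>i. sup_mean (f i)) - (\<Sum>i. sup_mean (f i))"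
      by (intro tendsto_intros summable_LIMSEQ sp)
    then have 1: "\<forall>\<^sub>F m in sequentially. (\<Sum>i. sup_mean (f i)) - (\<Sum>i<m. sup_mean (f i)) < e/3"
      using \<open>0 < e\<close> by (intro order_tendstoD) auto
    have "(\<lambda>m. norm ((\<Sum>i<m. f i) - v)) \<longlonglongrightarrow> norm (v - v)"
      using f unfolding sums_def by (intro tendsto_intros)
    then have 2: "\<forall>\<^sub>F m in sequentially. norm ((\<Sum>i<m. f i) - v) < e/3"
      using \<open>0 < e\<close> by (intro order_tendstoD) auto
    obtain m where m: "(\<Sum>i. sup_mean (f i)) - (\<Sum>i<m. sup_mean (f i)) < e/3" "norm ((\<Sum>i<m. f i) - v) < e/3"
      using eventually_happens'[OF sequentially_bot eventually_conj[OF 1 2]] by blast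
    define tail where "tail n = T n - (\<Sum>i<m. psum (f i) n)" for n
    have "(\<lambda>i. psum (f (i + m)) n) sums tail n" for n
      unfolding tail_def by (rule sums_split_initial_segment[OF T])
    then have "trunc_mean tail n \<le> (\<Sum>i. sup_mean (f (i + m)))" for n
      by (rule trunc_mean_suminf[OF _ trunc_mean_le_sup_mean summable_ignore_initial_segment[OF sp]])
    then have tail: "trunc_mean tail n < e/3" for n
      using suminf_minus_initial_segment[OF sp, of m] m(1) by (metis le_less_trans)
    define h where "h n = (\<Sum>i<m. psum (f i) n) - (\<Sum>i<m. f i)" for n
    have "((\<lambda>n. \<Sum>i<m. psum (f i) n) \<longlongrightarrow> (\<Sum>i<m. f i)) stat_filter"
      by (intro tendsto_sum psum_tendsto)
    then have "trunc_mean h \<longlonglongrightarrow> 0"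
      unfolding h_def by (simp only: stat_tendsto_iff)
    then have "\<forall>\<^sub>F n in sequentially. trunc_mean h n < e/3"
      using \<open>0 < e\<close> by (intro order_tendstoD) auto
    then show "\<forall>\<^sub>F n in sequentially. trunc_mean (\<lambda>n. T n - v) n < e"
    proof eventually_elim
      case (elim n)
      have "(\<lambda>n. T n - v) = (\<lambda>n. (h n + tail n) + ((\<Sum>i<m. f i) - v))"
        by (simp add: h_def tail_def fun_eq_iff)
      then have "trunc_mean (\<lambda>n. T n - v) n
          \<le> trunc_mean (\<lambda>n. h n + tail n) n + trunc_mean (\<lambda>n. (\<Sum>i<m. f i) - v) n"
        using trunc_mean_add[of "\<lambda>n. h n + tail n" "\<lambda>n. (\<Sum>i<m. f i) - v" n] by simp
      moreover have "trunc_mean (\<lambda>n. (\<Sum>i<m. f i) - v) n \<le> norm ((\<Sum>i<m. f i) - v)"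
        by (intro trunc_mean_bound) auto
      ultimately show ?case
        using trunc_mean_add[of h tail n] tail[of n] elim m(2) by linarith
    qed
  qed
  then have "(T \<longlongrightarrow> v) stat_filter"
    by (simp only: stat_tendsto_iff)
  then have "coord n v = b n" for n
    unfolding T_def by (rule coord_eqI)
  then have "psum v = T"
    by (simp add: psum_def T_def fun_eq_iff)
  then show ?thesis
    using T sp by (intro sup_mean_le) (auto intro!: trunc_mean_suminf trunc_mean_le_sup_mean)
qed

lemma coord_continuous: "continuous_on UNIV (coord n)"
proof -
  have p0: "(sup_mean \<longlongrightarrow> 0) (nhds 0)"
    by (rule zabreiko[OF sup_mean_nonneg sup_mean_minus sup_mean_absorbing sup_mean_countably_subadditive])
  have psum0: "((\<lambda>v. norm (psum v m)) \<longlongrightarrow> 0) (nhds 0)" for m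
  proof (rule Lim_null_comparison)
    have lim: "((\<lambda>v. real m * sup_mean v) \<longlongrightarrow> 0) (nhds 0)"
      using tendsto_mult[OF tendsto_const p0, of "real m"] by simp
    then show "((\<lambda>v. real m * sup_mean v) \<longlongrightarrow> 0) (nhds 0)" .
    have "\<forall>\<^sub>F v in nhds 0. real m * sup_mean v < 1"
      using lim by (intro order_tendstoD) auto
    then show "\<forall>\<^sub>F v in nhds 0. norm (norm (psum v m)) \<le> real m * sup_mean v"
    proof eventually_elim
      case (elim v)
      then show ?case using norm_psum_le_sup_mean[of v m] by simp
    qed
  qed
  have "(coord n \<longlongrightarrow> 0) (nhds 0)"
  proof (rule Lim_null_comparison)
    have "((\<lambda>v. (norm (psum v (Suc n)) + norm (psum v n)) / norm (x n)) \<longlongrightarrow> (0 + 0) / norm (x n)) (nhds 0)"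
      using basis_vector_nonzero by (intro tendsto_intros psum0) auto
    then show "((\<lambda>v. (norm (psum v (Suc n)) + norm (psum v n)) / norm (x n)) \<longlongrightarrow> 0) (nhds 0)"
      by simp
    show "\<forall>\<^sub>F v in nhds 0. norm (coord n v) \<le> (norm (psum v (Suc n)) + norm (psum v n)) / norm (x n)"
    proof (intro always_eventually allI)
      fix v
      show "norm (coord n v) \<le> (norm (psum v (Suc n)) + norm (psum v n)) / norm (x n)"
        using norm_coord[of n v] norm_triangle_ineq4[of "psum v (Suc n)" "psum v n"]
          basis_vector_nonzero[of n]
        by (simp add: pos_le_divide_eq)
    qed
  qed
  then have at_0: "(coord n \<longlongrightarrow> 0) (at 0)"
    by (rule filterlim_mono) (auto simp: at_within_le_nhds)
  have "isCont (coord n) u" for u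
  proof -
    have "((\<lambda>h. coord n (u + h) - coord n u) \<longlongrightarrow> 0) (at 0)"
      using at_0 by (simp add: coord_diff[symmetric])
    then have "((\<lambda>h. coord n (u + h)) \<longlongrightarrow> coord n u) (at 0)"
      by (simp add: LIM_zero_iff)
    then show ?thesis by (simp add: isCont_iff)
  qed
  then show ?thesis by (simp add: continuous_on_eq_continuous_at)
qed

end

theorem corollary1p1:
  fixes elem :: "'v \<Rightarrow> 'v \<Rightarrow> bool"
  assumes "zfc_universe elem"
    and "(\<exists>\<kappa>. zfc_universe.supercompact elem \<kappa>) \<or>
      (\<exists>\<mu>. zfc_universe.measurable_cardinal elem \<mu> \<and>
        infinite {\<delta>. zfc_universe.woodin elem \<delta> \<and> elem \<delta> \<mu>})"
  shows "(\<forall>x :: nat \<Rightarrow> 'a::banach.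
        filter_basis stat_filter scaleR x \<longrightarrow>
        (\<forall>n. continuous_on UNIV (coordinate stat_filter scaleR x n))) \<and>
      (\<forall>(scaleC :: complex \<Rightarrow> 'b::banach \<Rightarrow> 'b) (x :: nat \<Rightarrow> 'b).
        complex_banach_space scaleC \<longrightarrow>
        filter_basis stat_filter scaleC x \<longrightarrow>
        (\<forall>n. continuous_on UNIV (coordinate stat_filter scaleC x n)))"
proof (intro conjI allI impI)
  fix x :: "nat \<Rightarrow> 'a" and n
  assume "filter_basis stat_filter scaleR x"
  then interpret stat_basis scaleR x
    by unfold_locales (auto simp: algebra_simps)
  show "continuous_on UNIV (coordinate stat_filter scaleR x n)"
    by (rule coord_continuous)
next
  fix scaleC :: "complex \<Rightarrow> 'b \<Rightarrow> 'b" and x :: "nat \<Rightarrow> 'b" and n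
  assume "complex_banach_space scaleC" and basis: "filter_basis stat_filter scaleC x"
  then interpret complex_banach_space scaleC by simp
  interpret stat_basis scaleC x
    by unfold_locales (auto simp: scaleC_of_real norm_scaleC basis)
  show "continuous_on UNIV (coordinate stat_filter scaleC x n)"
    by (rule coord_continuous)
qed

end
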